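(* Let $n \ge 2$ be an integer, and for real $t>1$ consider the $t$-splitting measure $\nu_{n,t}^{\ast}$ on $S_n$. Then: (1) For every real $t > n-1$ one has $\nu_{n,t}^{\ast}(g) > 0$ for all $g \in S_n$; in particular, for these $t$, $\nu_{n,t}^{\ast}$ is a probability measure on $S_n$ with full support. (2) For every integer $k \in \{2,3,\dots,n-1\}$ one has $\nu_{n,k}^{\ast}(g) \ge 0$ for all $g \in S_n$, so $\nu_{n,k}^{\ast}$ is a probability measure on $S_n$; for these $k$ it does not have full support, and it vanishes on the conjugacy class of the identity $C_{\langle 1^n\rangle}$. (3) For every $g \in S_n$, $\lim_{t \to \infty} \nu_{n,t}^{\ast}(g) = \frac{1}{n!}$, the limit taken through positive real $t$.
   Context: For $m \ge 1$ the necklace polynomial is $M_m(X) = \frac{1}{m}\sum_{d \mid m} \mu(d) X^{m/d}$, where $\mu(d)$ is the Möbius function. For a complex number $w$ and integer $k\ge 0$, $\binom{w}{k} := \frac{w(w-1)\cdots(w-k+1)}{k!}$. For a partition $\mu$ of $n$, let $c_i(\mu)$ be the number of parts of $\mu$ equal to $i$, and let $C_\mu \subset S_n$ be the conjugacy class of permutations with cycle type $\mu$; $\langle 1^n\rangle$ denotes the partition with $n$ parts equal to 1. For $z \in \mathbb{C}\setminus\{0,1\}$ the $z$-splitting measure is defined on conjugacy classes by $\nu_{n,z}^{\ast}(C_\mu) = \frac{1}{z^{n-1}(z-1)}\prod_{i=1}^n \binom{M_i(z)}{c_i(\mu)}$, and on elements $g \in C_\mu$ by $\nu_{n,z}^{\ast}(g)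 = \nu_{n,z}^{\ast}(C_\mu)/|C_\mu|$, i.e. $\nu_{n,z}^{\ast}(g) = \frac{1}{n!}\cdot\frac{1}{z^{n-1}(z-1)}\prod_{i=1}^n i^{c_i(\mu)} c_i(\mu)! \binom{M_i(z)}{c_i(\mu)}$. *)

theory Defs
  imports
    "HOL-Probability.Probability"
    "HOL-Combinatorics.Orbits"
    "HOL-Algebra.Sym_Groups"
    "HOL-Computational_Algebra.Polynomial"
    "HOL-Computational_Algebra.Squarefree"
begin

definition moebius_mu :: "nat \<Rightarrow> int" where
  "moebius_mu d = (if squarefree d then (-1) ^ card (prime_factors d) else 0)"

definition necklace_poly :: "nat \<Rightarrow> 'a::field_char_0 poly" where
  "necklace_poly m =
     smult (1 / of_nat m) (\<Sum>d | d dvd m. monom (of_int (moebius_mu d)) (m div d))"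

text \<open>
  Partitions are multisets of positive integers. The cycles of a permutation of \<open>{1..n}\<close>,
  fixed points included, are its orbits on \<open>{1..n}\<close>; \<open>orbit\<close> only collects iterates with
  positive exponent, but for permutations of a finite set this contains the starting point.
\<close>

definition cycle_type :: "nat \<Rightarrow> (nat \<Rightarrow> nat) \<Rightarrow> nat multiset" where
  "cycle_type n g = image_mset card (mset_set (orbit g ` {1..n}))"

definition cycle_class :: "nat \<Rightarrow> nat multiset \<Rightarrow> (nat \<Rightarrow> nat) set" where
  "cycle_class n \<mu> = {g \<in> carrier (sym_group n). cycle_type n g = \<mu>}"

definition splitting_class :: "nat \<Rightarrow> 'a::field_char_0 \<Rightarrow> nat multiset \<Rightarrow> 'a" where
  "splitting_class n z \<mu> =
     1 / (z ^ (n - 1) * (z - 1)) * (\<Prod>i = 1..n. poly (necklace_poly i) z gchoose count \<mu> i)"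

definition splitting_weight :: "nat \<Rightarrow> 'a::field_char_0 \<Rightarrow> (nat \<Rightarrow> nat) \<Rightarrow> 'a" where
  "splitting_weight n z g =
     splitting_class n z (cycle_type n g) / of_nat (card (cycle_class n (cycle_type n g)))"

definition splitting_support :: "nat \<Rightarrow> 'a::field_char_0 \<Rightarrow> (nat \<Rightarrow> nat) set" where
  "splitting_support n z = {g \<in> carrier (sym_group n). splitting_weight n z g \<noteq> 0}"

text \<open>
  For real parameters the weights may be negative, and \<open>ennreal\<close> truncates negative values
  to \<open>0\<close>; the following measure represents the weights only where these are nonnegative.
\<close>

definition splitting_measure :: "nat \<Rightarrow> real \<Rightarrow> (nat \<Rightarrow> nat) measure" where
  "splitting_measure n t =
     point_measure (carrier (sym_group n)) (\<lambda>g. ennreal (splitting_weight n t g))"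

end

theory Submission
  imports Defs "HOL-Number_Theory.Number_Theory" "HOL-Real_Asymp.Real_Asymp"
begin

text \<open>
  Write \<open>M\<^sub>i\<close> for the necklace polynomials. Moebius inversion gives \<open>\<Sum>i | i dvd m. i * M\<^sub>i(z) = z ^ m\<close>;
  comparing logarithmic derivatives, \<open>\<Prod>\<^sub>i (1 + u ^ i) ^ M\<^sub>i(z) = (1 - z * u\<^sup>2) / (1 - z * u)\<close>,
  and the coefficient of \<open>u ^ n\<close> says that the total mass is \<open>1\<close>, once all partitions are known
  to be cycle types. For \<open>t > n - 1\<close> each factor is positive because \<open>M\<^sub>1(t) = t\<close> and
  \<open>i * M\<^sub>i(t) \<ge> t\<close> for \<open>i, t \<ge> 2\<close>, whence \<open>M\<^sub>i(t) > c - 1\<close> whenever \<open>i * c \<le> n\<close>. At an integer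
  \<open>k \<ge> 2\<close> the values \<open>M\<^sub>i(k)\<close> are nonnegative integers, so the factors are ordinary binomial
  coefficients. The limit follows from \<open>M\<^sub>i(t) \<sim> t ^ i / i\<close> and the class size
  \<open>n! / (\<Prod>\<^sub>i i ^ c\<^sub>i * c\<^sub>i!)\<close>.
\<close>

section \<open>Moebius inversion and necklace polynomials\<close>

lemma moebius_mu_1 [simp]: "moebius_mu (Suc 0) = 1"
  by (simp add: moebius_mu_def)

lemma moebius_mu_prime_mult:
  assumes "prime p" "\<not> p dvd d" "d > 0"
  shows "moebius_mu (p * d) = - moebius_mu d"
proof -
  have cop: "coprime p d" using assms prime_imp_coprime by blast
  have sf: "squarefree (p * d) \<longleftrightarrow> squarefree d"
    using cop assms by (metis squarefree_mult_coprime squarefree_multD(2) squarefree_prime)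
  have "prime_factors (p * d) = insert p (prime_factors d)"
    using assms by (simp add: prime_factors_product prime_factorization_prime)
  moreover have "p \<notin> prime_factors d" using assms by auto
  ultimately show ?thesis using sf by (simp add: moebius_mu_def)
qed

lemma moebius_mu_eq_0_if_square_dvd:
  assumes "prime p" "p * p dvd d"
  shows "moebius_mu d = 0"
proof -
  have "\<not> squarefree d" using assms
    by (metis not_prime_unit power2_eq_square squarefreeD)
  then show ?thesis by (simp add: moebius_mu_def)
qed

text \<open>Each divisor \<open>d\<close> prime to \<open>p\<close> is paired with
  \<open>p * d\<close>, which carries the opposite Moebius sign; divisors divisible by
  \<open>p * p\<close> have Moebius value 0. A constant \<open>f\<close> makes every difference
  vanish, while powers of an integer turn the differences into congruences modulo a power of
  \<open>p\<close>.\<close>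

lemma sum_moebius_mu_split_prime:
  fixes f :: "nat \<Rightarrow> 'a :: comm_ring_1"
  assumes "prime p" "p dvd n" "n > 0"
  shows "(\<Sum>d | d dvd n. of_int (moebius_mu d) * f d) =
    (\<Sum>d | d dvd n \<and> \<not> p dvd d. of_int (moebius_mu d) * (f d - f (p * d)))"
proof -
  define A where "A = {d. d dvd n \<and> \<not> p dvd d}"
  define B where "B = {d. d dvd n \<and> p dvd d}"
  let ?g = "\<lambda>d. of_int (moebius_mu d) * f d"
  have p0: "p > 0" using assms(1) prime_gt_0_nat by blast
  have fin: "finite A" "finite B" using assms unfolding A_def B_def by auto
  have "sum ?g {d. d dvd n} = sum ?g (A \<union> B)"
    by (rule sum.cong) (auto simp: A_def B_def)
  also have "\<dots> = sum ?g A + sum ?g B"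
    using fin by (rule sum.union_disjoint) (auto simp: A_def B_def)
  also have "sum ?g B = sum ?g ((\<lambda>d. p * d) ` A)"
  proof (rule sum.mono_neutral_right[OF fin(2)])
    show "(\<lambda>d. p * d) ` A \<subseteq> B"
    proof (clarsimp simp: A_def B_def)
      fix d assume "d dvd n" "\<not> p dvd d"
      moreover from this have "coprime p d" using assms prime_imp_coprime by blast
      ultimately show "p * d dvd n" using assms by (intro divides_mult)
    qed
    show "\<forall>d \<in> B - (\<lambda>d. p * d) ` A. ?g d = 0"
    proof
      fix d assume d: "d \<in> B - (\<lambda>d. p * d) ` A"
      then obtain e where e: "d = p * e" by (auto simp: B_def)
      with d have "p dvd e" by (auto simp: A_def B_def dest: dvd_mult_right)
      then have "moebius_mu d = 0"
        using e assms by (intro moebius_mu_eq_0_if_square_dvd[of p]) auto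
      then show "?g d = 0" by simp
    qed
  qed
  also have "\<dots> = (\<Sum>d\<in>A. ?g (p * d))"
    using p0 by (subst sum.reindex) (auto simp: inj_on_def)
  also have "\<dots> = (\<Sum>d\<in>A. - of_int (moebius_mu d) * f (p * d))"
    using assms dvd_pos_nat by (intro sum.cong) (auto simp: A_def moebius_mu_prime_mult)
  finally show ?thesis
    by (simp add: A_def sum.distrib[symmetric] algebra_simps sum_subtractf sum_negf)
qed

lemma sum_moebius_mu_divisors:
  assumes "n > 0"
  shows "(\<Sum>d | d dvd n. moebius_mu d) = (if n = 1 then 1 else 0)"
proof (cases "n = 1")
  case False
  then obtain p where "prime p" "p dvd n" using prime_factor_nat by blast
  from sum_moebius_mu_split_prime[OF this assms, of "\<lambda>_. 1::int"] False show ?thesis by simp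
qed simp

section \<open>Values of the necklace polynomials\<close>

lemma poly_necklace_poly:
  fixes z :: "'a :: field_char_0"
  assumes "m > 0"
  shows "of_nat m * poly (necklace_poly m) z = (\<Sum>d | d dvd m. of_int (moebius_mu d) * z ^ (m div d))"
  using assms by (simp add: necklace_poly_def poly_sum poly_monom)

lemma sum_divisors_div:
  fixes f :: "nat \<Rightarrow> 'a :: comm_monoid_add"
  assumes "m > 0"
  shows "(\<Sum>d | d dvd m. f (m div d)) = (\<Sum>d | d dvd m. f d)"
  using assms
  by (intro sum.reindex_bij_witness[of _ "\<lambda>d. m div d" "\<lambda>d. m div d"]) auto

text \<open>Moebius inversion: after exchanging the sums, the coefficient of \<open>z ^ e\<close> is
  the Moebius sum over the divisors of \<open>m div e\<close>, which is nonzero only for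
  \<open>e = m\<close>.\<close>

lemma sum_divisors_necklace:
  fixes z :: "'a :: field_char_0"
  assumes "m > 0"
  shows "(\<Sum>i | i dvd m. of_nat i * poly (necklace_poly i) z) = z ^ m"
proof -
  let ?mu = "\<lambda>d. of_int (moebius_mu d) :: 'a"
  have fin: "finite {i. i dvd k}" if "k dvd m" for k
    using that assms dvd_pos_nat by auto
  have "(\<Sum>i | i dvd m. of_nat i * poly (necklace_poly i) z)
      = (\<Sum>i | i dvd m. \<Sum>d | d dvd i. ?mu d * z ^ (i div d))"
    using assms dvd_pos_nat by (intro sum.cong refl poly_necklace_poly) auto
  also have "\<dots> = (\<Sum>i | i dvd m. \<Sum>e | e dvd i. ?mu (i div e) * z ^ e)"
  proof (rule sum.cong[OF refl])
    fix i assume "i \<in> {i. i dvd m}"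
    then have i: "i > 0" using assms dvd_pos_nat by auto
    have "(\<Sum>d | d dvd i. ?mu d * z ^ (i div d)) = (\<Sum>d | d dvd i. ?mu (i div (i div d)) * z ^ (i div d))"
      using i by (intro sum.cong) auto
    then show "(\<Sum>d | d dvd i. ?mu d * z ^ (i div d)) = (\<Sum>e | e dvd i. ?mu (i div e) * z ^ e)"
      using sum_divisors_div[OF i, of "\<lambda>e. ?mu (i div e) * z ^ e"] by simp
  qed
  also have "\<dots> = (\<Sum>(i, e)\<in>(SIGMA i:{i. i dvd m}. {e. e dvd i}). ?mu (i div e) * z ^ e)"
    using fin by (subst sum.Sigma) auto
  \<comment> \<open>Chains \<open>e dvd i\<close>, \<open>i dvd m\<close> are parametrized by
    \<open>e\<close> and the quotient \<open>d = i div e\<close>, which ranges over the divisors of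
    \<open>m div e\<close>.\<close>
  also have "\<dots> = (\<Sum>(e, d)\<in>(SIGMA e:{e. e dvd m}. {d. d dvd m div e}). ?mu d * z ^ e)"
    using assms
    by (intro sum.reindex_bij_witness[of _ "\<lambda>(e, d). (e * d, e)" "\<lambda>(i, e). (e, i div e)"])
       (auto elim!: dvdE intro: dvd_trans dvd_triv_left)
  also have "\<dots> = (\<Sum>e | e dvd m. \<Sum>d | d dvd m div e. ?mu d * z ^ e)"
    using assms by (subst sum.Sigma) (auto intro!: finite_divisors_nat simp: div_greater_zero_iff dvd_imp_le)
  also have "\<dots> = (\<Sum>e | e dvd m. of_int (\<Sum>d | d dvd m div e. moebius_mu d) * z ^ e)"
    by (simp add: sum_distrib_right)
  also have "\<dots> = (\<Sum>e | e dvd m. (if e = m then z ^ e else 0))"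
  proof (rule sum.cong[OF refl])
    fix e assume "e \<in> {e. e dvd m}"
    then obtain k where k: "m = e * k" by auto
    with assms have pos: "e > 0" "k > 0" by auto
    then have "m div e = k" "e = m \<longleftrightarrow> k = 1" using k by auto
    then show "of_int (\<Sum>d | d dvd m div e. moebius_mu d) * z ^ e = (if e = m then z ^ e else 0)"
      using sum_moebius_mu_divisors[OF pos(2)] by simp
  qed
  also have "\<dots> = z ^ m" using assms by simp
  finally show ?thesis .
qed

text \<open>For \<open>t \<ge> 2\<close> the leading power dominates the geometric sum of all lower powers.\<close>

lemma necklace_poly_lower_bound:
  fixes t :: real
  assumes "t \<ge> 2" "i \<ge> 2"
  shows "real i * poly (necklace_poly i) t \<ge> t"
proof -
  \<comment> \<open>The sum starts at exponent 1, which leaves the slack \<open>t\<close>; the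
    induction step rests on \<open>2 * t ^ k \<le> t ^ Suc k\<close>.\<close>
  have geo: "(\<Sum>j = 1..<k. t ^ j) \<le> t ^ k - t" if "k \<ge> 1" for k
    using that
  proof (induction k rule: dec_induct)
    case (step k)
    have "(\<Sum>j = 1..<Suc k. t ^ j) \<le> 2 * t ^ k - t" using step by simp
    also have "\<dots> \<le> t ^ Suc k - t" using assms by (simp add: mult_right_mono)
    finally show ?case .
  qed simp
  have mu: "\<bar>moebius_mu d\<bar> \<le> 1" for d by (simp add: moebius_mu_def power_abs)
  let ?D = "{d. d dvd i} - {1}"
  have "t ^ i - (\<Sum>d\<in>?D. t ^ (i div d)) \<le> t ^ i + (\<Sum>d\<in>?D. of_int (moebius_mu d) * t ^ (i div d))"
  proof -
    have "- (\<Sum>d\<in>?D. t ^ (i div d)) = (\<Sum>d\<in>?D. - 1 * t ^ (i div d))" by (simp add: sum_negf)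
    also have "\<dots> \<le> (\<Sum>d\<in>?D. of_int (moebius_mu d) * t ^ (i div d))"
    proof (intro sum_mono mult_right_mono)
      fix d show "- 1 \<le> real_of_int (moebius_mu d)" using mu[of d] by linarith
    qed (use assms in auto)
    finally show ?thesis by simp
  qed
  also have "\<dots> = real i * poly (necklace_poly i) t"
    using assms by (subst poly_necklace_poly) (auto simp: sum.remove[of _ 1])
  finally have 1: "t ^ i - (\<Sum>d\<in>?D. t ^ (i div d)) \<le> real i * poly (necklace_poly i) t" .
  \<comment> \<open>Distinct divisors give distinct exponents, and those from
    \<open>d \<noteq> 1\<close> lie in \<open>{1..<i}\<close>, so this is part of the geometric
    sum.\<close>
  have "(\<Sum>d\<in>?D. t ^ (i div d)) = (\<Sum>j\<in>(\<lambda>d. i div d) ` ?D. t ^ j)"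
  proof (subst sum.reindex)
    show "inj_on (\<lambda>d. i div d) ?D"
    proof (rule inj_onI)
      fix x y assume "x \<in> ?D" "y \<in> ?D" "i div x = i div y"
      then have "x * (i div x) = i" "y * (i div x) = i"
        by (metis (no_types, lifting) DiffD1 dvd_mult_div_cancel mem_Collect_eq)+
      then show "x = y" using assms
        by (metis mult_cancel2 mult_0_right not_numeral_le_zero)
    qed
  qed simp
  also have "\<dots> \<le> (\<Sum>j = 1..<i. t ^ j)"
  proof (intro sum_mono2)
    show "(\<lambda>d. i div d) ` ?D \<subseteq> {1..<i}"
    proof (rule image_subsetI)
      fix d assume "d \<in> ?D"
      then obtain e where "i = d * e" "d \<noteq> 1" by auto
      moreover from this have "d > 1" "e > 0" using assms by (auto intro: Nat.gr0I simp: nat_neq_iff)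
      ultimately show "i div d \<in> {1..<i}" by auto
    qed
  qed (use assms in auto)
  also have "\<dots> \<le> t ^ i - t" using assms by (intro geo) simp
  finally show ?thesis using 1 by linarith
qed

text \<open>If \<open>p\<close> does not divide \<open>x\<close>, this is Euler's theorem, since the
  totient of \<open>p ^ Suc a\<close> is \<open>p ^ Suc a - p ^ a\<close>. Otherwise both sides are
  divisible by \<open>p ^ Suc a\<close>, because \<open>a < p ^ a\<close>.\<close>

lemma power_prime_power_cong:
  fixes x p a :: nat
  assumes "prime p"
  shows "[x ^ (p ^ Suc a) = x ^ (p ^ a)] (mod p ^ Suc a)"
proof (cases "p dvd x")
  case False
  then have "coprime x (p ^ Suc a)"
    using assms by (simp add: coprime_commute prime_imp_coprime)
  then have "[x ^ totient (p ^ Suc a) = 1] (mod p ^ Suc a)" by (rule euler_theorem)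
  then have "[x ^ (p ^ a) * x ^ totient (p ^ Suc a) = x ^ (p ^ a) * 1] (mod p ^ Suc a)"
    by (rule cong_scalar_left)
  moreover have "p ^ a + totient (p ^ Suc a) = p ^ Suc a"
    using prime_gt_0_nat[OF assms]
    by (subst totient_prime_power_Suc[OF assms]) (simp flip: mult_Suc_right)
  ultimately show ?thesis by (simp flip: power_add)
next
  case True
  have "a < p ^ a" using assms prime_gt_1_nat by (simp add: power_gt_expt)
  then have *: "p ^ Suc a dvd x ^ (p ^ a)"
    using True by (meson Suc_leI dvd_power_same dvd_trans le_imp_power_dvd)
  moreover have "x ^ (p ^ a) dvd x ^ (p ^ Suc a)"
    using prime_gt_0_nat[OF assms] by (intro le_imp_power_dvd) simp
  ultimately show ?thesis
    by (meson cong_0_iff cong_sym cong_trans dvd_trans)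
qed

text \<open>Integrality is checked at each prime power \<open>p ^ Suc a\<close> exactly dividing \<open>i\<close>; pairing \<open>d\<close>
  with \<open>p * d\<close> reduces it to the Euler congruence \<open>x ^ p ^ Suc a = x ^ p ^ a\<close>.\<close>

lemma necklace_poly_of_nat_int:
  assumes "i > 0"
  shows "\<exists>c::int. poly (necklace_poly i) (of_nat k) = (of_int c :: 'a :: field_char_0)"
proof -
  define S where "S = (\<Sum>d | d dvd i. of_int (moebius_mu d) * int k ^ (i div d))"
  have "int i dvd S"
  proof (cases "S = 0")
    case False
    have pp: "p ^ Suc a dvd nat \<bar>S\<bar>" if p: "prime p" "multiplicity p i = Suc a" for p a
    proof -
      have pd: "p ^ Suc a dvd i" using p multiplicity_dvd by metis
      then have "p dvd i" using dvd_power[of "Suc a" p] dvd_trans by blast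
      from sum_moebius_mu_split_prime[OF p(1) this assms, of "\<lambda>d. int k ^ (i div d)"]
      have S: "S = (\<Sum>d | d dvd i \<and> \<not> p dvd d.
          of_int (moebius_mu d) * (int k ^ (i div d) - int k ^ (i div (p * d))))"
        unfolding S_def .
      have "int (p ^ Suc a) dvd S" unfolding S
      proof (intro dvd_sum dvd_mult)
        fix d assume "d \<in> {d. d dvd i \<and> \<not> p dvd d}"
        then have d: "d dvd i" "\<not> p dvd d" by auto
        have "coprime (p ^ Suc a) d" using d p prime_imp_coprime by auto
        then have "p ^ Suc a * d dvd i" using d pd by (intro divides_mult)
        then obtain e where e: "i = p ^ Suc a * d * e" by auto
        have pos: "p > 0" "d > 0" using assms e by auto
        have "i div d = p ^ Suc a * e" "i div (p * d) = p ^ a * e"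
          using pos by (auto simp: e mult_ac)
        \<comment> \<open>The two exponents are \<open>p ^ Suc a * e\<close> and
          \<open>p ^ a * e\<close>, so the congruence is applied to the base
          \<open>k ^ e\<close>.\<close>
        then show "int (p ^ Suc a) dvd int k ^ (i div d) - int k ^ (i div (p * d))"
          using power_prime_power_cong[OF p(1), of "k ^ e" a]
          by (metis cong_iff_dvd_diff cong_int_iff of_nat_power power_mult mult.commute)
      qed
      then show ?thesis by (metis abs_ge_zero dvd_abs_iff int_dvd_int_iff nat_0_le)
    qed
    have "i dvd nat \<bar>S\<bar>"
    proof (rule multiplicity_le_imp_dvd)
      show "multiplicity p i \<le> multiplicity p (nat \<bar>S\<bar>)" if "prime p" for p
        using pp[OF that] False that
        by (cases "multiplicity p i") (auto intro!: multiplicity_geI)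
    qed (use assms in auto)
    then show ?thesis by (metis int_dvd_int_iff dvd_abs_iff nat_0_le abs_ge_zero)
  qed simp
  then obtain c where c: "S = int i * c" by auto
  have "of_nat i * poly (necklace_poly i) (of_nat k) = (of_int S :: 'a)"
    using assms by (simp add: poly_necklace_poly S_def)
  with c assms show ?thesis by auto
qed

section \<open>Sizes of conjugacy classes\<close>

text \<open>The ground set is arbitrary so that permutations can be counted by adding one point at a
  time.\<close>

definition cycle_type_on :: "'a set \<Rightarrow> ('a \<Rightarrow> 'a) \<Rightarrow> nat multiset" where
  "cycle_type_on S g = image_mset card (mset_set (orbit g ` S))"

definition partitions_of :: "nat \<Rightarrow> nat multiset set" where
  "partitions_of n = {\<mu>. 0 \<notin># \<mu> \<and> sum_mset \<mu> = n}"

text \<open>The order of the centralizer of a permutation of cycle type \<mu>, usually written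
  \<open>z_\<mu>\<close>.\<close>

definition centralizer_order :: "nat multiset \<Rightarrow> nat" where
  "centralizer_order \<mu> = (\<Prod>i\<in>set_mset \<mu>. i ^ count \<mu> i * fact (count \<mu> i))"

section \<open>Orbits and cycle types of permutations of a finite set\<close>

lemma self_in_orbit_permutes:
  assumes "finite S" "q permutes S"
  shows "x \<in> orbit q x"
  by (rule permutation_self_in_orbit) (use assms in \<open>auto simp: permutation_permutes\<close>)

lemma orbit_eq_iff_mem:
  assumes "finite S" "q permutes S"
  shows "orbit q x = orbit q y \<longleftrightarrow> x \<in> orbit q y"
  using orbit_cyclic_eq3[OF cyclic_on_orbit[OF assms(2,1)]] self_in_orbit_permutes[OF assms]
  by metis

lemma pairwise_disjnt_orbits:
  assumes "finite S" "q permutes S"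
  shows "pairwise disjnt (orbit q ` S)"
proof -
  have "orbit q x = orbit q y" if "z \<in> orbit q x" "z \<in> orbit q y" for x y z
    using that orbit_eq_iff_mem[OF assms] by metis
  then show ?thesis by (fastforce simp: pairwise_def disjnt_iff)
qed

text \<open>\<open>g\<close> sends \<open>a\<close> to \<open>b\<close> and the
  \<open>q\<close>-preimage of \<open>b\<close> to \<open>a\<close>, and agrees with
  \<open>q\<close> on the rest of \<open>S\<close>. So \<open>a\<close> is spliced into the cycle of
  \<open>b\<close> just before \<open>b\<close>.\<close>

lemma orbit_transpose_comp:
  assumes "finite S" "q permutes S" "a \<notin> S" "b \<in> S"
  defines "g \<equiv> Transposition.transpose a b \<circ> q"
  shows "orbit g b = insert a (orbit q b)"
    and "x \<in> S \<Longrightarrow> x \<notin> orbit q b \<Longrightarrow> orbit g x = orbit q x"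
proof -
  note finS = assms(1) and q = assms(2) and bS = assms(4)
  have ga: "g a = b" using assms by (simp add: g_def permutes_not_in)
  have gS: "g y = (if q y = b then a else q y)" if "y \<in> S" for y
    using that assms permutes_in_image[OF q, of y] by (auto simp: g_def Transposition.transpose_def)
  have perm: "g permutes insert a S"
    unfolding g_def using assms by (intro permutes_compose permutes_swap_id) (auto intro: permutes_subset)
  have self: "y \<in> orbit g y" for y using self_in_orbit_permutes[OF _ perm] assms by simp
  have sub: "orbit q y \<subseteq> S" if "y \<in> S" for y using permutes_orbit_subset assms that by metis
  have le: "y \<in> insert a (orbit q b)" if "y \<in> orbit g b" for y
    using that
  proof induction
    case base
    then show ?case using gS[OF bS] by (auto intro: orbit.base)
  next
    case (step y)
    show ?case
    proof (cases "y = a")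
      case True
      then show ?thesis using ga self_in_orbit_permutes[OF finS q, of b] by simp
    next
      case False
      then have "y \<in> orbit q b" using step by simp
      moreover from this have "y \<in> S" using sub bS by blast
      ultimately show ?thesis using gS by (auto intro: orbit.step)
    qed
  qed
  \<comment> \<open>Conversely, \<open>g\<close> follows the walk of \<open>q\<close> from
    \<open>b\<close>, passing through \<open>a\<close> wherever \<open>q\<close> would step to
    \<open>b\<close>.\<close>
  have aq: "a \<in> orbit g b \<and> y \<in> orbit g b" if "y \<in> orbit q b" for y
  proof -
    have ab: "a \<in> orbit g b"
      using self[of a] ga orbit_step self_in_orbit_step by metis
    show ?thesis using that
    proof induction
      case base
      then show ?case using ab gS[OF bS] self[of b] orbit.base[of g b] by (auto split: if_splits)
    next
      case (step y)
      have "y \<in> S" using step sub assms by blast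
      then show ?case using ab gS[of y] self[of b] step orbit.step[of y g b] by (auto split: if_splits)
    qed
  qed
  show "orbit g b = insert a (orbit q b)"
    using le aq self_in_orbit_permutes[OF finS q, of b] by blast
  show "orbit g x = orbit q x" if "x \<in> S" "x \<notin> orbit q b"
  proof (rule orbit_cong[OF self_in_orbit_permutes[OF finS q]])
    fix s assume s: "s \<in> orbit q x"
    then have "q s \<in> orbit q x" by (rule orbit.step)
    then have "q s \<noteq> b" using that orbit_eq_iff_mem[OF finS q] 
      by (metis self_in_orbit_permutes[OF finS q])
    moreover have "s \<in> S" using s sub[OF that(1)] by blast
    ultimately show "g s = q s" using gS by simp
  qed
qed

text \<open>Among the orbits only the block of \<open>b\<close> changes, gaining \<open>a\<close>.
  The new block differs from all others, since those lie inside \<open>S\<close>.\<close>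

lemma cycle_type_on_transpose_comp:
  assumes "finite S" "q permutes S" "a \<notin> S" "b \<in> S"
  shows "card (orbit q b) \<in># cycle_type_on S q"
    and "cycle_type_on (insert a S) (Transposition.transpose a b \<circ> q) =
      add_mset (Suc (card (orbit q b))) (cycle_type_on S q - {#card (orbit q b)#})"
proof -
  let ?g = "Transposition.transpose a b \<circ> q"
  let ?O = "orbit q ` S - {orbit q b}"
  have fin: "finite ?O" using assms by auto
  have sub: "orbit q y \<subseteq> S" if "y \<in> S" for y using permutes_orbit_subset assms that by metis
  have "orbit ?g ` insert a S = insert (insert a (orbit q b)) ?O" (is "?L = ?R")
  proof
    have "orbit ?g x \<in> ?R" if "x \<in> insert a S" for x
    proof (cases "x = a \<or> x \<in> orbit q b")
      case True
      then have "x \<in> orbit ?g b" using orbit_transpose_comp(1)[OF assms] by auto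
      then have "orbit ?g x = orbit ?g b"
        using assms by (subst orbit_eq_iff_mem[of "insert a S"])
          (auto intro!: permutes_compose permutes_swap_id intro: permutes_subset)
      then show ?thesis using orbit_transpose_comp(1)[OF assms] by auto
    next
      case False
      then have "orbit ?g x = orbit q x" "orbit q x \<noteq> orbit q b"
        using orbit_transpose_comp(2)[OF assms] that orbit_eq_iff_mem[OF assms(1,2)] by auto
      then show ?thesis using False that by auto
    qed
    then show "?L \<subseteq> ?R" by blast
    have "insert a (orbit q b) \<in> ?L" using orbit_transpose_comp(1)[OF assms] assms(4) by blast
    moreover have "orbit q x \<in> ?L" if "x \<in> S" "orbit q x \<noteq> orbit q b" for x
      using orbit_transpose_comp(2)[OF assms that(1)] that orbit_eq_iff_mem[OF assms(1,2)]
      by (metis image_eqI insertI2)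
    ultimately show "?R \<subseteq> ?L" by blast
  qed
  moreover have "insert a (orbit q b) \<notin> ?O" using sub assms(3) by blast
  moreover have "card (insert a (orbit q b)) = Suc (card (orbit q b))"
    using sub[OF assms(4)] assms by (meson card_insert_disjoint finite_subset subsetD)
  ultimately have 1: "cycle_type_on (insert a S) ?g =
      add_mset (Suc (card (orbit q b))) (image_mset card (mset_set ?O))"
    using fin by (simp add: cycle_type_on_def)
  have "mset_set (orbit q ` S) = add_mset (orbit q b) (mset_set ?O)"
    using assms by (metis finite_imageI imageI mset_set.remove)
  then have 2: "cycle_type_on S q = add_mset (card (orbit q b)) (image_mset card (mset_set ?O))"
    by (simp add: cycle_type_on_def)
  show "card (orbit q b) \<in># cycle_type_on S q" using 2 by simp
  show "cycle_type_on (insert a S) ?g =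
      add_mset (Suc (card (orbit q b))) (cycle_type_on S q - {#card (orbit q b)#})"
    using 1 2 by simp
qed

lemma cycle_type_on_insert_fixed:
  assumes "finite S" "q permutes S" "a \<notin> S"
  shows "cycle_type_on (insert a S) q = add_mset 1 (cycle_type_on S q)"
proof -
  have a: "orbit q a = {a}" using assms by (simp add: orbit_eq_singleton_iff permutes_not_in)
  have "{a} \<notin> orbit q ` S" using permutes_orbit_subset[OF assms(2)] assms(3) by blast
  then show ?thesis using assms a by (simp add: cycle_type_on_def)
qed

text \<open>The orbits of size \<open>m\<close> cut these points into blocks of size
  \<open>m\<close>. In the class count this is the number of insertion points that enlarge a cycle
  of length \<open>m\<close>.\<close>

lemma card_points_in_orbits_of_card:
  assumes "finite S" "q permutes S"
  shows "card {b \<in> S. card (orbit q b) = m} = m * count (cycle_type_on S q) m"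
proof -
  let ?O = "{X \<in> orbit q ` S. card X = m}"
  have sub: "orbit q y \<subseteq> S" if "y \<in> S" for y using permutes_orbit_subset assms that by metis
  have U: "\<Union>?O = {b \<in> S. card (orbit q b) = m}"
  proof (intro equalityI subsetI)
    fix b assume "b \<in> \<Union>?O"
    then obtain x where x: "x \<in> S" "card (orbit q x) = m" "b \<in> orbit q x" by auto
    then have "orbit q b = orbit q x" using orbit_eq_iff_mem[OF assms] by metis
    then show "b \<in> {b \<in> S. card (orbit q b) = m}" using x sub by auto
  next
    fix b assume "b \<in> {b \<in> S. card (orbit q b) = m}"
    then show "b \<in> \<Union>?O" using self_in_orbit_permutes[OF assms, of b] by blast
  qed
  have "m * card ?O = card (\<Union>?O)"
  proof (rule card_partition)
    show "finite (\<Union> ?O)" using U assms by simp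
    show "c1 \<inter> c2 = {}" if "c1 \<in> ?O" "c2 \<in> ?O" "c1 \<noteq> c2" for c1 c2
      using that pairwise_disjnt_orbits[OF assms] by (auto simp: pairwise_def disjnt_def)
  qed (use assms in auto)
  moreover have "count (cycle_type_on S q) m = card ?O"
  proof -
    have "count (cycle_type_on S q) m = (\<Sum>X\<in>card -` {m} \<inter> orbit q ` S. 1)"
      using assms unfolding cycle_type_on_def count_image_mset by (intro sum.cong) auto
    also have "card -` {m} \<inter> orbit q ` S = ?O" by auto
    finally show ?thesis by simp
  qed
  ultimately show ?thesis using U by simp
qed

text \<open>Orbits are nonempty, pairwise disjoint and cover \<open>S\<close>.\<close>

lemma cycle_type_on_in_partitions_of:
  assumes "finite S" "q permutes S"
  shows "cycle_type_on S q \<in> partitions_of (card S)"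
proof -
  have sub: "orbit q y \<subseteq> S" if "y \<in> S" for y using permutes_orbit_subset assms that by metis
  have "0 \<notin># cycle_type_on S q"
    using assms sub orbit_nonempty[of q] by (auto simp: cycle_type_on_def) (metis card_0_eq finite_subset)
  moreover have "(\<Sum>X\<in>orbit q ` S. card X) = card (\<Union>(orbit q ` S))"
    using pairwise_disjnt_orbits[OF assms] sub assms
    by (intro card_Union_disjoint[symmetric]) (auto dest: finite_subset)
  moreover have "\<Union>(orbit q ` S) = S" using sub self_in_orbit_permutes[OF assms] by blast
  ultimately show ?thesis using assms by (simp add: partitions_of_def cycle_type_on_def sum_unfold_sum_mset)
qed

section \<open>Centralizer orders and the number of permutations of a given cycle type\<close>

lemma centralizer_order_superset:
  assumes "finite A" "set_mset \<mu> \<subseteq> A"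
  shows "centralizer_order \<mu> = (\<Prod>i\<in>A. i ^ count \<mu> i * fact (count \<mu> i))"
  unfolding centralizer_order_def
proof (rule prod.mono_neutral_left[OF assms], rule ballI)
  fix i assume "i \<in> A - set_mset \<mu>"
  then have "count \<mu> i = 0" by (simp add: count_eq_zero_iff)
  then show "i ^ count \<mu> i * fact (count \<mu> i) = 1" by simp
qed

text \<open>Raising the multiplicity of \<open>m\<close> from \<open>c\<close> to
  \<open>c + 1\<close> changes only the factor at \<open>m\<close>:
  \<open>m ^ (c + 1) * (c + 1)! = m * (c + 1) * (m ^ c * c!)\<close>.\<close>

lemma centralizer_order_add_mset:
  "centralizer_order (add_mset m \<mu>) = m * Suc (count \<mu> m) * centralizer_order \<mu>"
proof -
  let ?A = "insert m (set_mset \<mu>)"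
  have "centralizer_order (add_mset m \<mu>) = (\<Prod>i\<in>?A. i ^ count (add_mset m \<mu>) i * fact (count (add_mset m \<mu>) i))"
    by (rule centralizer_order_superset) auto
  also have "\<dots> = (\<Prod>i\<in>?A. (if i = m then m * Suc (count \<mu> m) else 1) * (i ^ count \<mu> i * fact (count \<mu> i)))"
    by (intro prod.cong) (auto simp: algebra_simps)
  also have "\<dots> = m * Suc (count \<mu> m) * (\<Prod>i\<in>?A. i ^ count \<mu> i * fact (count \<mu> i))"
    by (subst prod.distrib) simp
  also have "(\<Prod>i\<in>?A. i ^ count \<mu> i * fact (count \<mu> i)) = centralizer_order \<mu>"
    by (rule centralizer_order_superset[symmetric]) auto
  finally show ?thesis .
qed

lemma sum_mset_count:
  fixes \<mu> :: "nat multiset"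
  assumes "finite A" "set_mset \<mu> \<subseteq> A"
  shows "(\<Sum>k\<in>A. k * count \<mu> k) = sum_mset \<mu>"
  using assms(2)
proof (induction \<mu>)
  case (add x \<mu>)
  have "(\<Sum>k\<in>A. k * count (add_mset x \<mu>) k) = (\<Sum>k\<in>A. (if k = x then k else 0) + k * count \<mu> k)"
    by (intro sum.cong) auto
  also have "\<dots> = x + (\<Sum>k\<in>A. k * count \<mu> k)"
    using add.prems assms(1) by (simp add: sum.distrib)
  finally show ?case using add by simp
qed simp

text \<open>Induction on \<open>S\<close>: a permutation of \<open>insert a S\<close> arises from a permutation \<open>q\<close> of \<open>S\<close> either
  by making \<open>a\<close> a fixed point, or by inserting \<open>a\<close> in front of some \<open>b \<in> S\<close> into the cycle of \<open>b\<close>,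
  which turns a part \<open>k - 1\<close> of the cycle type into \<open>k\<close>. The contributions of the parts \<open>k\<close> of
  \<open>\<mu>\<close> to the count are \<open>k * count \<mu> k\<close> and add up to \<open>card (insert a S)\<close>.\<close>

lemma card_cycle_type_on:
  assumes "finite S" "\<mu> \<in> partitions_of (card S)"
  shows "card {q. q permutes S \<and> cycle_type_on S q = \<mu>} * centralizer_order \<mu> = fact (card S)"
  using assms
proof (induction S arbitrary: \<mu>)
  case empty
  then have "\<mu> = {#}" by (auto simp: partitions_of_def) (metis multiset_nonemptyE)
  moreover have "{q. q permutes {} \<and> cycle_type_on {} q = {#}} = {id :: 'a \<Rightarrow> 'a}"
    by (auto simp: cycle_type_on_def)
  ultimately show ?case by (simp add: centralizer_order_def)
next
  case (insert a S)
  note [simp] = finite_permutations[OF insert.hyps(1)]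
  define n where "n = card S"
  define N where "N \<sigma> = card {q. q permutes S \<and> cycle_type_on S q = \<sigma>}" for \<sigma>
  \<comment> \<open>\<open>L k\<close> is the cycle type that becomes \<mu> when a part
    \<open>k - 1\<close> is enlarged to \<open>k\<close>. The value \<open>k = 1\<close> is left out
    of \<open>?K\<close>: a cycle of length 1 through \<open>a\<close> is a fixed point, treated in
    \<open>fixed\<close>.\<close>
  define L where "L k = add_mset (k - 1) (\<mu> - {#k#})" for k
  let ?K = "set_mset \<mu> - {1}"
  let ?P = "{q. q permutes S}"
  let ?z = "centralizer_order"
  have IH: "N \<sigma> * ?z \<sigma> = fact n" if "\<sigma> \<in> partitions_of n" for \<sigma>
    using insert.IH that by (simp add: N_def n_def)
  have N_sum: "N \<sigma> = (\<Sum>q\<in>?P. of_bool (cycle_type_on S q = \<sigma>))" for \<sigma>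
    by (simp add: N_def Int_def sum.If_cases of_bool_def)
  have mu: "0 \<notin># \<mu>" "sum_mset \<mu> = Suc n"
    using insert by (auto simp: partitions_of_def n_def)
  have fixed: "(\<Sum>q\<in>?P. of_bool (add_mset 1 (cycle_type_on S q) = \<mu>)) * ?z \<mu> = count \<mu> 1 * fact n"
  proof (cases "1 \<in># \<mu>")
    case True
    then obtain \<rho> where \<rho>: "\<mu> = add_mset 1 \<rho>" by (metis insert_DiffM)
    with mu have "\<rho> \<in> partitions_of n" by (auto simp: partitions_of_def)
    then have "N \<rho> * ?z \<rho> = fact n" by (rule IH)
    then show ?thesis
      by (simp add: \<rho> centralizer_order_add_mset N_sum algebra_simps del: mult_Suc_right mult_Suc)
  next
    case False
    then have "add_mset 1 \<sigma> \<noteq> \<mu>" for \<sigma> by auto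
    then show ?thesis using False by (simp add: not_in_iff)
  qed
  have ins: "(\<Sum>b\<in>S. of_bool (cycle_type_on (insert a S) (Transposition.transpose a b \<circ> q) = \<mu>))
      = (\<Sum>k\<in>?K. of_bool (cycle_type_on S q = L k) * ((k - 1) * count (L k) (k - 1)))"
    if q: "q permutes S" for q
  proof -
    let ?c = "cycle_type_on S q"
    have c0: "0 \<notin># ?c" using cycle_type_on_in_partitions_of[OF insert.hyps(1) q]
      by (simp add: partitions_of_def)
    have "(\<Sum>b\<in>S. of_bool (cycle_type_on (insert a S) (Transposition.transpose a b \<circ> q) = \<mu>))
        = (\<Sum>b\<in>S. \<Sum>k\<in>?K. of_bool (?c = L k) * of_bool (card (orbit q b) = k - 1) :: nat)"
    proof (rule sum.cong[OF refl])
      fix b assume b: "b \<in> S"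
      let ?m = "card (orbit q b)"
      note ct = cycle_type_on_transpose_comp[OF insert.hyps(1) q insert.hyps(2) b]
      have m0: "?m > 0" using ct(1) c0 by (metis gr0I)
      have "(add_mset (Suc ?m) (?c - {#?m#}) = \<mu>) \<longleftrightarrow> Suc ?m \<in># \<mu> \<and> ?c = L (Suc ?m)"
        using ct(1) by (auto simp: L_def)
      \<comment> \<open>As \<open>?m\<close> is positive, \<open>?m = k - 1\<close> selects exactly
        \<open>k = Suc ?m\<close>, so each \<open>b\<close> contributes to at most one part
        \<open>k\<close>.\<close>
      moreover have "(\<Sum>k\<in>?K. of_bool (?c = L k) * of_bool (?m = k - 1) :: nat)
          = (\<Sum>k\<in>?K. if k = Suc ?m then of_bool (?c = L (Suc ?m)) else 0)"
        using m0 mu(1) by (intro sum.cong) auto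
      ultimately show "of_bool (cycle_type_on (insert a S) (Transposition.transpose a b \<circ> q) = \<mu>)
          = (\<Sum>k\<in>?K. of_bool (?c = L k) * of_bool (?m = k - 1) :: nat)"
        unfolding ct(2) using m0 by simp
    qed
    also have "\<dots> = (\<Sum>k\<in>?K. of_bool (?c = L k) * (\<Sum>b\<in>S. of_bool (card (orbit q b) = k - 1)))"
      by (subst sum.swap) (simp add: sum_distrib_left)
    also have "\<dots> = (\<Sum>k\<in>?K. of_bool (?c = L k) * ((k - 1) * count (L k) (k - 1)))"
    proof (rule sum.cong[OF refl])
      fix k
      have "(\<Sum>b\<in>S. of_bool (card (orbit q b) = k - 1)) = card {b \<in> S. card (orbit q b) = k - 1}"
        using insert.hyps(1) by (simp add: Int_def of_bool_def sum.If_cases)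
      then show "of_bool (?c = L k) * (\<Sum>b\<in>S. of_bool (card (orbit q b) = k - 1))
          = of_bool (?c = L k) * ((k - 1) * count (L k) (k - 1))"
        using card_points_in_orbits_of_card[OF insert.hyps(1) q, of "k - 1"]
        by (cases "?c = L k") simp_all
    qed
    finally show ?thesis .
  qed
  have part: "N (L k) * ((k - 1) * count (L k) (k - 1)) * ?z \<mu> = k * count \<mu> k * fact n"
    if k: "k \<in> ?K" for k
  proof -
    from k obtain \<rho> where \<rho>: "\<mu> = add_mset k \<rho>" by (metis DiffD1 insert_DiffM)
    have k2: "k \<ge> 2" using k mu(1) by (cases k rule: nat.exhaust) (auto simp: numeral_2_eq_2 Suc_le_eq intro: Nat.gr0I)
    have L: "L k = add_mset (k - 1) \<rho>" by (simp add: L_def \<rho>)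
    have "L k \<in> partitions_of n" using mu k2 by (auto simp: L \<rho> partitions_of_def)
    then have *: "N (L k) * ?z (L k) = fact n" by (rule IH)
    \<comment> \<open>The centralizer orders of \<mu> and \<open>L k\<close> are that of \<rho>
      times \<open>k * count \<mu> k\<close> and \<open>(k - 1) * count (L k) (k - 1)\<close>
      respectively, so both sides are the same product.\<close>
    have "N (L k) * ((k - 1) * count (L k) (k - 1)) * ?z \<mu> = k * count \<mu> k * (N (L k) * ?z (L k))"
      unfolding L \<rho> centralizer_order_add_mset by (simp add: algebra_simps del: mult_Suc mult_Suc_right)
    then show ?thesis using * by simp
  qed
  have "card {p. p permutes insert a S \<and> cycle_type_on (insert a S) p = \<mu>}
      = (\<Sum>p | p permutes insert a S. of_bool (cycle_type_on (insert a S) p = \<mu>))"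
    using insert.hyps(1) by (simp add: finite_permutations Int_def sum.If_cases of_bool_def)
  \<comment> \<open>Every permutation of \<open>insert a S\<close> is
    \<open>transpose a b \<circ> q\<close> for a unique pair \<open>b\<close>, \<open>q\<close>; the
    choice \<open>b = a\<close> gives those fixing \<open>a\<close>.\<close>
  also have "\<dots> = (\<Sum>b\<in>insert a S. \<Sum>q\<in>?P.
      of_bool (cycle_type_on (insert a S) (Transposition.transpose a b \<circ> q) = \<mu>))"
    using insert.hyps by (rule sum_over_permutations_insert)
  also have "\<dots> = (\<Sum>q\<in>?P. of_bool (cycle_type_on (insert a S) q = \<mu>))
      + (\<Sum>q\<in>?P. \<Sum>b\<in>S. of_bool (cycle_type_on (insert a S) (Transposition.transpose a b \<circ> q) = \<mu>))"
    by (simp only: sum.insert[OF insert.hyps] transpose_same id_o sum.swap[of _ S ?P])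
  also have "(\<Sum>q\<in>?P. of_bool (cycle_type_on (insert a S) q = \<mu>))
      = (\<Sum>q\<in>?P. of_bool (add_mset 1 (cycle_type_on S q) = \<mu>) :: nat)"
    using cycle_type_on_insert_fixed[OF insert.hyps(1) _ insert.hyps(2)] by (intro sum.cong) auto
  also have "(\<Sum>q\<in>?P. \<Sum>b\<in>S. of_bool (cycle_type_on (insert a S) (Transposition.transpose a b \<circ> q) = \<mu>))
      = (\<Sum>q\<in>?P. \<Sum>k\<in>?K. of_bool (cycle_type_on S q = L k) * ((k - 1) * count (L k) (k - 1)))"
    using ins by (intro sum.cong) auto
  also have "\<dots> = (\<Sum>k\<in>?K. N (L k) * ((k - 1) * count (L k) (k - 1)))"
    unfolding N_sum sum_distrib_right by (rule sum.swap)
  finally have "card {p. p permutes insert a S \<and> cycle_type_on (insert a S) p = \<mu>} * ?z \<mu>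
      = count \<mu> 1 * fact n + (\<Sum>k\<in>?K. k * count \<mu> k * fact n)"
    using fixed part by (simp add: add_mult_distrib sum_distrib_right)
  also have "\<dots> = (\<Sum>k\<in>insert 1 (set_mset \<mu>). k * count \<mu> k) * fact n"
    by (subst sum.remove[of _ 1]) (auto simp: add_mult_distrib sum_distrib_right)
  also have "(\<Sum>k\<in>insert 1 (set_mset \<mu>). k * count \<mu> k) = Suc n"
    using sum_mset_count[of "insert 1 (set_mset \<mu>)" \<mu>] mu by auto
  finally show ?case using insert.hyps by (simp add: n_def)
qed

section \<open>Total mass\<close>

unbundle no vec_syntax and fps_syntax

section \<open>Power series and their logarithmic derivatives\<close>

text \<open>The series \<open>(1 + u ^ i) ^ c\<close> and \<open>u ^ i / (1 + u ^ i)\<close>.\<close>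

definition fps_binomial_power :: "'a :: field_char_0 \<Rightarrow> nat \<Rightarrow> 'a fps" where
  "fps_binomial_power c i = Abs_fps (\<lambda>k. if i dvd k then c gchoose (k div i) else 0)"

definition fps_alternating :: "nat \<Rightarrow> 'a :: field_char_0 fps" where
  "fps_alternating i = Abs_fps (\<lambda>k. if i dvd k \<and> k > 0 then (- 1) ^ (k div i + 1) else 0)"

text \<open>The operator \<open>u * d/du\<close> replaces the plain derivative because it scales
  coefficients without shifting their indices.\<close>

lemma fps_X_mult_deriv_nth [simp]: "(fps_X * fps_deriv F) $ k = of_nat k * F $ k"
  for F :: "'a :: field_char_0 fps"
  by (cases k) auto

lemma fps_X_deriv_mult:
  "fps_X * fps_deriv (F * G) = fps_X * fps_deriv F * G + F * (fps_X * fps_deriv G)"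
  for F :: "'a :: field_char_0 fps"
  by (simp add: algebra_simps)

text \<open>Both sides are compared after multiplication by \<open>1 + u ^ i\<close>, which clears
  the denominator of \<open>fps_alternating i\<close> and can be cancelled because its constant term
  is 1.\<close>

lemma fps_binomial_power_log_deriv:
  assumes "i > 0"
  shows "fps_X * fps_deriv (fps_binomial_power c i)
    = fps_const (of_nat i * c) * fps_alternating i * fps_binomial_power c i"
proof -
  let ?B = "fps_binomial_power c i" and ?L = "fps_alternating i :: 'a fps"
  have 1: "(1 + fps_X ^ i) * (fps_X * fps_deriv ?B) = fps_const (of_nat i * c) * (fps_X ^ i * ?B)"
  proof (rule fps_ext)
    fix k
    show "((1 + fps_X ^ i) * (fps_X * fps_deriv ?B)) $ k = (fps_const (of_nat i * c) * (fps_X ^ i * ?B)) $ k"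
    proof (cases "k < i")
      case True
      then show ?thesis using assms
        by (auto simp: distrib_right fps_X_power_mult_nth fps_binomial_power_def dest: dvd_imp_le)
    next
      case False
      then obtain l where l: "k = i + l" by (metis le_Suc_ex not_less)
      \<comment> \<open>For \<open>l = i * j\<close> this is \<open>i\<close> times the recurrence
        \<open>j * (c gchoose j) + (j + 1) * (c gchoose (j + 1)) = c * (c gchoose j)\<close>; if
        \<open>i\<close> does not divide \<open>l\<close>, all terms are 0.\<close>
      have "of_nat k * ?B $ k + of_nat l * ?B $ l = of_nat i * c * ?B $ l"
      proof (cases "i dvd l")
        case True
        then obtain j where j: "l = i * j" by auto
        have "of_nat k * ?B $ k + of_nat l * ?B $ l =
            of_nat i * (of_nat j * (c gchoose j) + of_nat (Suc j) * (c gchoose Suc j))"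
          using assms by (simp add: l j fps_binomial_power_def algebra_simps)
        also have "\<dots> = of_nat i * (c * (c gchoose j))" by (simp only: gbinomial_mult_1)
        finally show ?thesis using assms by (simp add: j fps_binomial_power_def)
      qed (simp add: l fps_binomial_power_def)
      moreover have "((1 + fps_X ^ i) * (fps_X * fps_deriv ?B)) $ k = of_nat k * ?B $ k + of_nat l * ?B $ l"
        by (simp only: distrib_right fps_add_nth mult_1_left fps_X_power_mult_nth fps_X_mult_deriv_nth l) simp
      moreover have "(fps_const (of_nat i * c) * (fps_X ^ i * ?B)) $ k = of_nat i * c * ?B $ l"
        by (simp only: fps_mult_left_const_nth fps_X_power_mult_nth l) simp
      ultimately show ?thesis by (simp only:)
    qed
  qed
  have 2: "(1 + fps_X ^ i) * ?L = fps_X ^ i"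
  proof (rule fps_ext)
    fix k
    show "((1 + fps_X ^ i) * ?L) $ k = (fps_X ^ i :: 'a fps) $ k"
    proof (cases "k < i")
      case True
      then show ?thesis using assms
        by (auto simp: distrib_right fps_X_power_mult_nth fps_alternating_def dest: dvd_imp_le)
    next
      case False
      then obtain l where l: "k = i + l" by (metis le_Suc_ex not_less)
      show ?thesis using assms
        by (auto simp: l distrib_right fps_X_power_mult_nth fps_alternating_def)
    qed
  qed
  have "((1 + fps_X ^ i) :: 'a fps) $ 0 \<noteq> 0" using assms by simp
  then have nz: "(1 + fps_X ^ i :: 'a fps) \<noteq> 0" by force
  have "(1 + fps_X ^ i) * (fps_X * fps_deriv ?B) = (1 + fps_X ^ i) * (fps_const (of_nat i * c) * ?L * ?B)"
    unfolding 1 by (subst 2[symmetric]) (simp add: mult_ac)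
  then show ?thesis using nz by simp
qed

lemma fps_prod_log_deriv:
  fixes B L :: "nat \<Rightarrow> 'a :: field_char_0 fps"
  assumes "finite A" "\<And>i. i \<in> A \<Longrightarrow> fps_X * fps_deriv (B i) = L i * B i"
  shows "fps_X * fps_deriv (\<Prod>i\<in>A. B i) = (\<Sum>i\<in>A. L i) * (\<Prod>i\<in>A. B i)"
  using assms
proof (induction A)
  case (insert a A)
  have "fps_X * fps_deriv (\<Prod>i\<in>insert a A. B i) = fps_X * fps_deriv (B a * (\<Prod>i\<in>A. B i))"
    using insert by simp
  also have "\<dots> = L a * B a * (\<Prod>i\<in>A. B i) + B a * ((\<Sum>i\<in>A. L i) * (\<Prod>i\<in>A. B i))"
    using insert by (subst fps_X_deriv_mult) simp
  finally show ?case using insert by (simp add: algebra_simps)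
qed simp

text \<open>Since \<open>H $ 0 = 0\<close>, the coefficient of \<open>H * F\<close> at
  \<open>n\<close> involves only earlier coefficients of \<open>F\<close>, so
  \<open>of_nat n * F $ n\<close> is determined recursively. Agreement of \<open>H\<close> and
  \<open>H'\<close> up to \<open>N\<close> is enough, which permits truncated products.\<close>

lemma fps_log_deriv_unique:
  fixes F G H H' :: "'a :: field_char_0 fps"
  assumes "fps_X * fps_deriv F = H * F" "fps_X * fps_deriv G = H' * G"
    and "F $ 0 = G $ 0" "H $ 0 = 0" "\<And>m. m \<le> N \<Longrightarrow> H $ m = H' $ m" "n \<le> N"
  shows "F $ n = G $ n"
  using assms(6)
proof (induction n rule: less_induct)
  case (less n)
  show ?case
  proof (cases "n = 0")
    case False
    have H0: "H' $ 0 = 0" using assms(4,5) by force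
    have "of_nat n * F $ n = (H * F) $ n" using assms(1) fps_X_mult_deriv_nth by metis
    also have "\<dots> = (H' * G) $ n"
      unfolding fps_mult_nth
    proof (intro sum.cong refl)
      fix i assume "i \<in> {0..n}"
      then show "H $ i * F $ (n - i) = H' $ i * G $ (n - i)"
        using less assms(4,5) H0 False by (cases "i = 0") auto
    qed
    also have "\<dots> = of_nat n * G $ n" using assms(2) fps_X_mult_deriv_nth by metis
    finally show ?thesis using False by simp
  qed (use assms in auto)
qed

section \<open>Partitions with bounded parts and the coefficients of the product\<close>

definition bounded_partitions :: "nat \<Rightarrow> nat \<Rightarrow> nat multiset set" where
  "bounded_partitions N n = {\<mu>. set_mset \<mu> \<subseteq> {1..N} \<and> sum_mset \<mu> = n}"

text \<open>Parts are positive, so a partition of \<open>n\<close> has at most \<open>n\<close> of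
  them and comes from a list of bounded length over a finite set.\<close>

lemma finite_bounded_partitions: "finite (bounded_partitions N n)"
proof (rule finite_subset)
  have size_le: "size \<mu> \<le> sum_mset \<mu>" if "set_mset \<mu> \<subseteq> {1..N}" for \<mu> :: "nat multiset"
    using that by (induction \<mu>) auto
  show "bounded_partitions N n \<subseteq> mset ` {xs. set xs \<subseteq> {1..N} \<and> length xs \<le> n}"
  proof
    fix \<mu> assume \<mu>: "\<mu> \<in> bounded_partitions N n"
    obtain xs where xs: "\<mu> = mset xs" using ex_mset by metis
    then have "set xs \<subseteq> {1..N}" "length xs \<le> n"
      using \<mu> size_le[of \<mu>] by (auto simp: bounded_partitions_def)
    then show "\<mu> \<in> mset ` {xs. set xs \<subseteq> {1..N} \<and> length xs \<le> n}" using xs by blast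
  qed
  show "finite (mset ` {xs. set xs \<subseteq> {1..N} \<and> length xs \<le> n})"
    by (intro finite_imageI finite_lists_length_le) simp
qed

lemma partitions_of_eq_bounded: "partitions_of n = bounded_partitions n n"
proof -
  have "set_mset \<mu> \<subseteq> {1..n}" if "0 \<notin># \<mu>" "sum_mset \<mu> = n" for \<mu>
  proof
    fix k assume k: "k \<in># \<mu>"
    then obtain \<rho> where "\<mu> = add_mset k \<rho>" by (blast dest: multi_member_split)
    then have "k \<le> sum_mset \<mu>" by simp
    moreover have "k \<noteq> 0" using k that(1) by (intro notI) simp
    ultimately show "k \<in> {1..n}" using that by simp
  qed
  then show ?thesis by (auto simp: partitions_of_def bounded_partitions_def)
qed

text \<open>Induction on the largest admissible part: the last factor of the Cauchy product chooses
  the multiplicity of the part \<open>Suc N\<close>, and the others account for a partition of the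
  remaining \<open>j\<close> into smaller parts.\<close>

lemma fps_prod_binomial_power_nth:
  fixes c :: "nat \<Rightarrow> 'a :: field_char_0"
  shows "(\<Prod>i = 1..N. fps_binomial_power (c i) i) $ n
    = (\<Sum>\<mu>\<in>bounded_partitions N n. \<Prod>i = 1..N. c i gchoose count \<mu> i)"
proof (induction N arbitrary: n)
  case 0
  have "bounded_partitions 0 n = (if n = 0 then {{#}} else {})"
    by (auto simp: bounded_partitions_def)
  then show ?case by simp
next
  case (Suc N)
  let ?M = "Suc N"
  note [simp del] = mult_Suc mult_Suc_right
  let ?J = "{j \<in> {0..n}. ?M dvd n - j}"
  let ?f = "\<lambda>N \<mu>. \<Prod>i = 1..N. c i gchoose count \<mu> i"
  \<comment> \<open>Rewrites the truncated subtraction and divisibility in \<open>?J\<close> as the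
    equation \<open>n = j + ?M * e\<close>.\<close>
  have split: "\<exists>j \<mu> e. x = (j, \<mu>) \<and> n = j + ?M * e \<and> \<mu> \<in> bounded_partitions N j"
    if "x \<in> (SIGMA j:?J. bounded_partitions N j)" for x
  proof -
    from that obtain j \<mu> where x: "x = (j, \<mu>)" "j \<le> n" "?M dvd n - j" "\<mu> \<in> bounded_partitions N j"
      by auto
    then obtain e where "n - j = ?M * e" by blast
    then have "n = j + ?M * e" using x(2) by linarith
    then show ?thesis using x by blast
  qed
  have "(\<Prod>i = 1..?M. fps_binomial_power (c i) i) $ n
      = (\<Sum>j = 0..n. (\<Sum>\<mu>\<in>bounded_partitions N j. ?f N \<mu>) * fps_binomial_power (c ?M) ?M $ (n - j))"
    using Suc.IH by (simp add: fps_mult_nth)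
  also have "\<dots> = (\<Sum>j\<in>?J. \<Sum>\<mu>\<in>bounded_partitions N j. ?f N \<mu> * (c ?M gchoose ((n - j) div ?M)))"
    by (intro sum.mono_neutral_cong_right) (auto simp: fps_binomial_power_def sum_distrib_right)
  also have "\<dots> = (\<Sum>(j, \<mu>)\<in>(SIGMA j:?J. bounded_partitions N j). ?f N \<mu> * (c ?M gchoose ((n - j) div ?M)))"
    by (subst sum.Sigma) (auto simp: finite_bounded_partitions)
  also have "\<dots> = (\<Sum>\<mu>\<in>bounded_partitions ?M n. ?f ?M \<mu>)"
  \<comment> \<open>A partition is split into its parts other than \<open>?M\<close>, with sum
    \<open>j\<close>, and its \<open>(n - j) div ?M\<close> copies of \<open>?M\<close>.\<close>
  proof (rule sum.reindex_bij_witness[of _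
        "\<lambda>\<mu>. (n - ?M * count \<mu> ?M, filter_mset (\<lambda>i. i \<noteq> ?M) \<mu>)"
        "\<lambda>(j, \<mu>). \<mu> + replicate_mset ((n - j) div ?M) ?M"], goal_cases)
    case (1 x)
    then obtain j \<mu> e where x: "x = (j, \<mu>)" "n = j + ?M * e" "\<mu> \<in> bounded_partitions N j"
      using split by blast
    then have "?M \<notin># \<mu>" by (auto simp: bounded_partitions_def)
    then have "count \<mu> ?M = 0" "filter_mset (\<lambda>i. i \<noteq> ?M) \<mu> = \<mu>"
      by (simp_all add: count_eq_zero_iff filter_mset_eq_conv) metis
    moreover have "filter_mset (\<lambda>i. i \<noteq> ?M) (replicate_mset k ?M) = {#}" for k
      by (induction k) auto
    ultimately show ?case using x by simp
  next
    case (2 x)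
    then obtain j \<mu> e where x: "x = (j, \<mu>)" "n = j + ?M * e" "\<mu> \<in> bounded_partitions N j"
      using split by blast
    then show ?case
      by (auto simp: bounded_partitions_def sum_mset_replicate_mset split: if_splits)
  next
    case (3 \<mu>)
    define k where "k = count \<mu> ?M"
    define \<rho> where "\<rho> = filter_mset (\<lambda>i. i \<noteq> ?M) \<mu>"
    have "\<mu> = \<rho> + replicate_mset k ?M"
      by (rule multiset_eqI) (auto simp: \<rho>_def k_def)
    moreover from this have "n = sum_mset \<rho> + ?M * k"
      using 3 by (auto simp: bounded_partitions_def)
    ultimately show ?case by (simp add: \<rho>_def k_def)
  next
    case (4 \<mu>)
    define k where "k = count \<mu> ?M"
    define \<rho> where "\<rho> = filter_mset (\<lambda>i. i \<noteq> ?M) \<mu>"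
    have mu: "\<mu> = \<rho> + replicate_mset k ?M"
      by (rule multiset_eqI) (auto simp: \<rho>_def k_def)
    then have n: "n = sum_mset \<rho> + ?M * k"
      using 4 by (auto simp: bounded_partitions_def)
    have "set_mset \<rho> \<subseteq> {1..N}" using 4 by (auto simp: \<rho>_def bounded_partitions_def le_Suc_eq)
    then have "\<rho> \<in> bounded_partitions N (n - ?M * k)" using n by (simp add: bounded_partitions_def)
    then show ?case using n unfolding \<rho>_def[symmetric] k_def[symmetric] by simp
  next
    case (5 x)
    then obtain j \<mu> e where x: "x = (j, \<mu>)" "n = j + ?M * e" "\<mu> \<in> bounded_partitions N j"
      using split by blast
    then have "?M \<notin># \<mu>" by (auto simp: bounded_partitions_def)
    then have "count \<mu> ?M = 0" by (simp add: not_in_iff)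
    then show ?case using x by simp
  qed
  finally show ?case .
qed

text \<open>The sign is -1 exactly when \<open>m div i\<close> is even, that is, when
  \<open>m\<close> is even and \<open>i\<close> divides \<open>m div 2\<close>; it is written as 1
  minus twice an indicator.\<close>

lemma sum_alternating_divisors:
  fixes x :: "nat \<Rightarrow> 'a :: comm_ring_1"
  assumes "m > 0"
  shows "(\<Sum>i | i dvd m. (- 1) ^ (m div i + 1) * x i)
    = (\<Sum>i | i dvd m. x i) - 2 * (if even m then \<Sum>i | i dvd m div 2. x i else 0)"
proof -
  let ?E = "{i. i dvd m \<and> even (m div i)}"
  have fin: "finite {i. i dvd m}" using assms by simp
  have "(\<Sum>i | i dvd m. (- 1) ^ (m div i + 1) * x i) = (\<Sum>i | i dvd m. x i - 2 * (if even (m div i) then x i else 0))"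
    by (intro sum.cong) (auto simp: uminus_power_if)
  also have "\<dots> = (\<Sum>i | i dvd m. x i) - 2 * (\<Sum>i\<in>?E. x i)"
    using fin by (simp add: sum_subtractf sum_distrib_left[symmetric] sum.inter_filter[symmetric])
  also have "(\<Sum>i\<in>?E. x i) = (if even m then \<Sum>i | i dvd m div 2. x i else 0)"
  proof (cases "even m")
    case True
    then obtain h where h: "m = 2 * h" by auto
    have "i dvd h" if "i dvd m" "even (m div i)" for i
    proof -
      from that obtain e where "m div i = 2 * e" by auto
      then have "m = i * (2 * e)" using that by (metis dvd_mult_div_cancel)
      then show ?thesis using h by simp
    qed
    moreover have "even (m div i)" if "i dvd h" for i using that h
      by (metis div_mult_swap dvd_triv_left)
    ultimately have "?E = {i. i dvd h}" using h by auto
    then show ?thesis using h by simp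
  next
    case False
    then have "?E = {}" by (metis (mono_tags, lifting) Collect_empty_eq dvd_div_mult_self dvd_mult2)
    then show ?thesis using False by (simp only: sum.empty if_False)
  qed
  finally show ?thesis .
qed

text \<open>\<open>G\<close> is \<open>(1 - z * u\<^sup>2) / (1 - z * u)\<close>, which for a prime
  power \<open>z\<close> counts monic squarefree polynomials over the field with \<open>z\<close>
  elements. Its coefficient at 1 is \<open>z\<close>, not \<open>z - 1\<close>, because the
  numerator has no linear term. \<open>H\<close> is \<open>z * u / (1 - z * u) - 2 * z * u\<^sup>2 /
  (1 - z * u\<^sup>2)\<close>.\<close>

lemma fps_squarefree_log_deriv:
  fixes z :: "'a :: field_char_0"
  defines "G \<equiv> Abs_fps (\<lambda>n. if n = 0 then 1 else if n = 1 then z else z ^ n - z ^ (n - 1))"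
    and "H \<equiv> Abs_fps (\<lambda>m. if m = 0 then 0 else z ^ m - 2 * (if even m then z ^ (m div 2) else 0))"
  shows "fps_X * fps_deriv G = H * G"
proof -
  define E1 where "E1 = Abs_fps (\<lambda>m. if m = 0 then 0 else z ^ m)"
  define E2 where "E2 = Abs_fps (\<lambda>m. if m = 0 then 0 else if even m then z ^ (m div 2) else 0)"
  let ?X = "fps_X :: 'a fps"
  let ?z = "fps_const z"
  have H: "H = E1 - 2 * E2"
    by (rule fps_ext) (simp add: H_def E1_def E2_def numeral_fps_const)
  have E1: "(1 - ?z * ?X) * E1 = ?z * ?X"
  proof (rule fps_ext)
    fix k show "((1 - ?z * ?X) * E1) $ k = (?z * ?X) $ k"
      by (cases k) (auto simp: left_diff_distrib mult.assoc E1_def)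
  qed
  have E2: "(1 - ?z * ?X ^ 2) * E2 = ?z * ?X ^ 2"
  proof (rule fps_ext)
    fix k
    consider "k = 0" | "k = 1" | l where "k = Suc (Suc l)" by (metis One_nat_def not0_implies_Suc)
    then show "((1 - ?z * ?X ^ 2) * E2) $ k = (?z * ?X ^ 2) $ k"
      by cases (auto simp: left_diff_distrib mult.assoc E2_def fps_X_power_mult_nth fps_X_power_nth)
  qed
  have G: "(1 - ?z * ?X) * G = 1 - ?z * ?X ^ 2"
  proof (rule fps_ext)
    fix k
    consider "k = 0" | "k = 1" | "k = 2" | l where "k = Suc (Suc (Suc l))"
      by (metis One_nat_def not0_implies_Suc numeral_2_eq_2)
    then show "((1 - ?z * ?X) * G) $ k = (1 - ?z * ?X ^ 2) $ k"
      by cases (auto simp: left_diff_distrib mult.assoc G_def fps_X_power_nth power2_eq_square algebra_simps)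
  qed
  have "?X * fps_deriv ((1 - ?z * ?X) * G) = ?X * fps_deriv (1 - ?z * ?X ^ 2)" using G by simp
  then have G': "(1 - ?z * ?X) * (?X * fps_deriv G) = ?z * ?X * G - 2 * ?z * ?X ^ 2"
    by (simp add: fps_deriv_power algebra_simps power2_eq_square)
  have "((1 - ?z * ?X) * (1 - ?z * ?X ^ 2)) $ 0 \<noteq> 0" by simp
  then have nz: "(1 - ?z * ?X) * (1 - ?z * ?X ^ 2) \<noteq> 0" by force
  \<comment> \<open>Multiplying by both denominators avoids quotients of series; the common factor
    has constant term 1 and is cancelled at the end.\<close>
  have "(1 - ?z * ?X) * (1 - ?z * ?X ^ 2) * (?X * fps_deriv G)
      = (1 - ?z * ?X ^ 2) * (?z * ?X * G - 2 * ?z * ?X ^ 2)"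
    using G' by (simp add: mult_ac)
  also have "\<dots> = ?z * ?X * (1 - ?z * ?X ^ 2) * G - 2 * ?z * ?X ^ 2 * ((1 - ?z * ?X) * G)"
    unfolding G by (simp add: algebra_simps)
  also have "\<dots> = ((1 - ?z * ?X) * E1) * (1 - ?z * ?X ^ 2) * G
      - 2 * ((1 - ?z * ?X ^ 2) * E2) * ((1 - ?z * ?X) * G)"
    unfolding E1 E2 by (simp add: mult_ac)
  also have "\<dots> = (1 - ?z * ?X) * (1 - ?z * ?X ^ 2) * (H * G)"
    unfolding H by (simp add: algebra_simps)
  finally show ?thesis using nz by (metis mult_cancel_left)
qed

text \<open>The factors with \<open>i \<le> n\<close> suffice, since every divisor of a positive
  \<open>m \<le> n\<close> is among these \<open>i\<close>. At such \<open>m\<close> the logarithmic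
  derivative of the product is a signed divisor sum of \<open>i * M\<^sub>i(z)\<close>, which
  Moebius inversion evaluates.\<close>

lemma sum_partitions_necklace_gchoose:
  fixes z :: "'a :: field_char_0"
  assumes "n \<ge> 2"
  shows "(\<Sum>\<mu>\<in>partitions_of n. \<Prod>i = 1..n. poly (necklace_poly i) z gchoose count \<mu> i)
    = z ^ n - z ^ (n - 1)"
proof -
  let ?M = "\<lambda>i. poly (necklace_poly i) z"
  define F where "F = (\<Prod>i = 1..n. fps_binomial_power (?M i) i)"
  define G where "G = Abs_fps (\<lambda>n. if n = 0 then 1 else if n = 1 then z else z ^ n - z ^ (n - 1))"
  define H where "H = (\<Sum>i = 1..n. fps_const (of_nat i * ?M i) * fps_alternating i)"
  define H' where "H' = Abs_fps (\<lambda>m. if m = 0 then 0 else z ^ m - 2 * (if even m then z ^ (m div 2) else 0))"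
  have H0: "H $ 0 = 0" by (simp add: H_def fps_sum_nth fps_alternating_def)
  have "F $ n = G $ n"
  proof (rule fps_log_deriv_unique[of F H G H' n])
    show "fps_X * fps_deriv F = H * F" unfolding F_def H_def
      by (rule fps_prod_log_deriv) (auto intro!: fps_binomial_power_log_deriv)
    show "fps_X * fps_deriv G = H' * G" unfolding G_def H'_def
      by (rule fps_squarefree_log_deriv)
    have "(\<Prod>i\<in>A. f i) $ 0 = (\<Prod>i\<in>A. f i $ 0)" for A and f :: "nat \<Rightarrow> 'a fps"
      by (induction A rule: infinite_finite_induct) auto
    then show "F $ 0 = G $ 0" by (simp add: F_def G_def fps_binomial_power_def)
    show "H $ m = H' $ m" if "m \<le> n" for m
    proof (cases "m = 0")
      case False
      have "H $ m = (\<Sum>i = 1..n. of_nat i * ?M i * fps_alternating i $ m)"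
        by (simp add: H_def fps_sum_nth)
      also have "\<dots> = (\<Sum>i | i dvd m. (- 1) ^ (m div i + 1) * (of_nat i * ?M i))"
      proof (rule sum.mono_neutral_cong_right)
        show "{i. i dvd m} \<subseteq> {1..n}"
        proof
          fix i assume "i \<in> {i. i dvd m}"
          then have "i > 0" "i \<le> m" using False by (auto dest: dvd_imp_le intro: Nat.gr0I)
          then show "i \<in> {1..n}" using that by simp
        qed
      qed (use False in \<open>auto simp: fps_alternating_def\<close>)
      also have "\<dots> = z ^ m - 2 * (if even m then z ^ (m div 2) else 0)"
        using False by (subst sum_alternating_divisors) (auto simp: sum_divisors_necklace elim!: evenE)
      finally show ?thesis using False by (simp add: H'_def)
    qed (simp add: H0 H'_def)
  qed (use H0 in auto)
  then show ?thesis using assms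
    unfolding F_def fps_prod_binomial_power_nth partitions_of_eq_bounded by (simp add: G_def)
qed

section \<open>The splitting measure\<close>

lemma cycle_type_eq: "cycle_type n g = cycle_type_on {1..n} g"
  by (simp add: cycle_type_def cycle_type_on_def)

lemma cycle_type_in_partitions_of:
  "g \<in> carrier (sym_group n) \<Longrightarrow> cycle_type n g \<in> partitions_of n"
  using cycle_type_on_in_partitions_of[of "{1..n}" g] by (simp add: cycle_type_eq sym_group_carrier)

lemma card_cycle_class:
  assumes "\<mu> \<in> partitions_of n"
  shows "card (cycle_class n \<mu>) * centralizer_order \<mu> = fact n"
  using card_cycle_type_on[of "{1..n}" \<mu>] assms
  by (simp add: cycle_class_def cycle_type_eq sym_group_carrier)

text \<open>The product with the centralizer order is \<open>fact n\<close>, so the class is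
  nonempty: every partition is a cycle type.\<close>

lemma card_cycle_class_pos:
  assumes "\<mu> \<in> partitions_of n"
  shows "card (cycle_class n \<mu>) > 0"
  using card_cycle_class[OF assms] by (intro Nat.gr0I) simp

lemma mult_count_le_partitions_of:
  assumes "\<mu> \<in> partitions_of n"
  shows "i * count \<mu> i \<le> n"
proof -
  have "(\<Sum>k\<in>insert i (set_mset \<mu>). k * count \<mu> k) = n"
    using assms sum_mset_count[of "insert i (set_mset \<mu>)" \<mu>] by (auto simp: partitions_of_def)
  then show ?thesis
    using member_le_sum[of i "insert i (set_mset \<mu>)" "\<lambda>k. k * count \<mu> k"] by simp
qed

lemma finite_carrier_sym_group: "finite (carrier (sym_group n))"
  by (simp add: sym_group_def finite_permutations)

text \<open>Grouping by cycle type cancels the class sizes and leaves the sum over partitions, whose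
  value is the normalizing factor.\<close>

lemma sum_splitting_weight:
  fixes z :: "'a :: field_char_0"
  assumes "n \<ge> 2" "z \<noteq> 0" "z \<noteq> 1"
  shows "(\<Sum>g\<in>carrier (sym_group n). splitting_weight n z g) = 1"
proof -
  have fin: "finite (partitions_of n)"
    by (simp add: partitions_of_eq_bounded finite_bounded_partitions)
  have "(\<Sum>g\<in>carrier (sym_group n). splitting_weight n z g)
      = (\<Sum>\<mu>\<in>partitions_of n. \<Sum>g\<in>cycle_class n \<mu>. splitting_weight n z g)"
    unfolding cycle_class_def
    by (rule sum.group[OF finite_carrier_sym_group fin, symmetric]) (auto intro: cycle_type_in_partitions_of)
  also have "\<dots> = (\<Sum>\<mu>\<in>partitions_of n. splitting_class n z \<mu>)"
  proof (rule sum.cong[OF refl])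
    fix \<mu> assume "\<mu> \<in> partitions_of n"
    then have "card (cycle_class n \<mu>) > 0" by (rule card_cycle_class_pos)
    moreover have "(\<Sum>g\<in>cycle_class n \<mu>. splitting_weight n z g)
        = (\<Sum>g\<in>cycle_class n \<mu>. splitting_class n z \<mu> / of_nat (card (cycle_class n \<mu>)))"
      by (intro sum.cong) (auto simp: splitting_weight_def cycle_class_def)
    ultimately show "(\<Sum>g\<in>cycle_class n \<mu>. splitting_weight n z g) = splitting_class n z \<mu>" by simp
  qed
  also have "\<dots> = 1 / (z ^ (n - 1) * (z - 1)) * (z ^ n - z ^ (n - 1))"
    unfolding splitting_class_def sum_distrib_left[symmetric]
      sum_partitions_necklace_gchoose[OF assms(1)] ..
  also have "z ^ n - z ^ (n - 1) = z ^ (n - 1) * (z - 1)"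
    using assms(1) by (cases n) (auto simp: algebra_simps)
  finally show ?thesis using assms by simp
qed

lemma prob_space_splitting_measure:
  assumes "n \<ge> 2" "t \<noteq> 0" "t \<noteq> 1"
    and nonneg: "\<And>g. g \<in> carrier (sym_group n) \<Longrightarrow> splitting_weight n t g \<ge> 0"
  shows "prob_space (splitting_measure n t)"
proof (rule prob_spaceI)
  have "emeasure (splitting_measure n t) (space (splitting_measure n t))
      = (\<Sum>g\<in>carrier (sym_group n). ennreal (splitting_weight n t g))"
    by (simp add: splitting_measure_def space_point_measure emeasure_point_measure_finite
        finite_carrier_sym_group)
  \<comment> \<open>Nonnegativity ensures that \<open>ennreal\<close> truncates nothing, so the real
    sum carries over.\<close>
  also have "\<dots> = 1" using nonneg sum_splitting_weight[OF assms(1-3)] by (simp add: sum_ennreal)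
  finally show "emeasure (splitting_measure n t) (space (splitting_measure n t)) = 1" .
qed

section \<open>Signs, zeros and limits of the weights\<close>

lemma gchoose_pos:
  fixes a :: real
  assumes "a > real c - 1"
  shows "a gchoose c > 0"
  unfolding gbinomial_prod_rev using assms by (intro divide_pos_pos prod_pos) auto

lemma poly_necklace_poly_1 [simp]: "poly (necklace_poly (Suc 0)) z = z"
  using poly_necklace_poly[of "Suc 0" z] by simp

text \<open>Serves the case \<open>n = 2\<close>, where \<open>t\<close> may lie between 1 and 2,
  outside the range of the general lower bound.\<close>

lemma poly_necklace_poly_2: "2 * poly (necklace_poly 2) z = z ^ 2 - z"
proof -
  have "{d::nat. d dvd 2} = {1, 2}"
    using two_is_prime_nat by (auto simp: prime_nat_iff)
  moreover have "moebius_mu 2 = -1" using moebius_mu_prime_mult[of 2 1] by simp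
  ultimately show ?thesis using poly_necklace_poly[of 2 z] by simp
qed

text \<open>For \<open>i \<ge> 2\<close> and \<open>n \<ge> 3\<close>,
  \<open>i * M\<^sub>i(t) \<ge> t > n - 1 \<ge> i * c - 1\<close> gives
  \<open>i * (M\<^sub>i(t) - (c - 1)) > i - 1\<close>.\<close>

lemma necklace_poly_gt:
  fixes t :: real
  assumes "n \<ge> 2" "t > real n - 1" "i \<in> {1..n}" "i * c \<le> n"
  shows "poly (necklace_poly i) t > real c - 1"
proof (cases "i = 1")
  case True
  then show ?thesis using assms by simp
next
  case False
  then have i: "i \<ge> 2" using assms by simp
  show ?thesis
  proof (cases "n = 2")
    case True
    then have "t * t > t * 1" using assms by (intro mult_strict_left_mono) auto
    then have pos: "poly (necklace_poly 2) t > 0"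
      using poly_necklace_poly_2[of t] by (simp add: power2_eq_square)
    have "i = 2" using i assms(3) True by simp
    moreover from this have "c \<le> 1" using assms(4) True by simp
    ultimately show ?thesis using pos by auto
  next
    case False
    then have "t \<ge> 2" using assms by linarith
    from necklace_poly_lower_bound[OF this i] have "t \<le> real i * poly (necklace_poly i) t" .
    moreover have "real i * real c \<le> real n" using assms(4) by (metis of_nat_le_iff of_nat_mult)
    ultimately have "real i * (poly (necklace_poly i) t - (real c - 1)) > 0"
      using assms i by (simp add: algebra_simps)
    then show ?thesis using i by (simp add: zero_less_mult_iff)
  qed
qed

lemma gchoose_necklace_nonneg:
  assumes "k \<ge> 2" "i \<ge> 1"
  shows "poly (necklace_poly i) (real k) gchoose c \<ge> 0"
proof -
  obtain m :: int where m: "poly (necklace_poly i) (real k) = of_int m"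
    using necklace_poly_of_nat_int[of i k] assms by auto
  have "poly (necklace_poly i) (real k) \<ge> 0"
  proof (cases "i = 1")
    case False
    then have "real k \<le> real i * poly (necklace_poly i) (real k)"
      using assms by (intro necklace_poly_lower_bound) auto
    then have "0 \<le> real i * poly (necklace_poly i) (real k)" using assms by linarith
    then show ?thesis using assms by (simp add: zero_le_mult_iff)
  qed simp
  then have "poly (necklace_poly i) (real k) = real (nat m)" using m by simp
  then show ?thesis by (simp flip: binomial_gbinomial)
qed

lemma splitting_weight_pos:
  fixes t :: real
  assumes "n \<ge> 2" "t > real n - 1" "g \<in> carrier (sym_group n)"
  shows "splitting_weight n t g > 0"
proof -
  let ?\<mu> = "cycle_type n g"
  have \<mu>: "?\<mu> \<in> partitions_of n" using assms(3) by (rule cycle_type_in_partitions_of)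
  have "(\<Prod>i = 1..n. poly (necklace_poly i) t gchoose count ?\<mu> i) > 0"
    using assms mult_count_le_partitions_of[OF \<mu>]
    by (intro prod_pos ballI gchoose_pos necklace_poly_gt[of n]) auto
  then show ?thesis using assms card_cycle_class_pos[OF \<mu>]
    by (simp add: splitting_weight_def splitting_class_def)
qed

lemma splitting_weight_of_nat_nonneg:
  assumes "k \<ge> 2"
  shows "splitting_weight n (real k) g \<ge> 0"
proof -
  have "(\<Prod>i = 1..n. poly (necklace_poly i) (real k) gchoose count (cycle_type n g) i) \<ge> 0"
    using assms by (intro prod_nonneg ballI gchoose_necklace_nonneg) auto
  then show ?thesis using assms by (simp add: splitting_weight_def splitting_class_def)
qed

text \<open>The factor at \<open>i = 1\<close> is \<open>k choose n\<close>, which vanishes for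
  \<open>k < n\<close>.\<close>

lemma splitting_class_identity_eq_0:
  assumes "k < n"
  shows "splitting_class n (of_nat k :: 'a :: field_char_0) (replicate_mset n 1) = 0"
proof -
  have "poly (necklace_poly 1) (of_nat k :: 'a) gchoose count (replicate_mset n 1) (1::nat) = 0"
    using assms by (simp flip: binomial_gbinomial)
  then show ?thesis using assms unfolding splitting_class_def
    by (subst prod_zero[of "{1..n}"]) auto
qed

lemma cycle_type_id: "cycle_type n id = replicate_mset n 1"
proof -
  have "orbit id x = {x}" for x :: nat by (simp add: orbit_eq_singleton_iff)
  then have "orbit id ` {1..n} = (\<lambda>x. {x}) ` {1..n}" by simp
  then have "cycle_type n id = image_mset card (image_mset (\<lambda>x. {x}) (mset_set {1..n}))"
    by (simp add: cycle_type_def image_mset_mset_set)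
  then show ?thesis by (simp add: image_mset_const_eq multiset.map_comp o_def)
qed

text \<open>After division by \<open>t ^ i\<close> only the summand \<open>d = 1\<close> survives;
  every other one has exponent \<open>i div d < i\<close>.\<close>

lemma tendsto_necklace_poly:
  assumes "i > 0"
  shows "((\<lambda>t::real. poly (necklace_poly i) t / t ^ i) \<longlongrightarrow> 1 / real i) at_top"
proof -
  let ?f = "\<lambda>t::real. (\<Sum>d | d dvd i. of_int (moebius_mu d) * (t ^ (i div d) / t ^ i)) / real i"
  have "(?f \<longlongrightarrow> (\<Sum>d | d dvd i. of_int (moebius_mu d) * (if d = 1 then 1 else 0)) / real i) at_top"
  proof (intro tendsto_intros)
    fix d assume "d \<in> {d. d dvd i}"
    then obtain e where e: "i = d * e" by auto
    then have pos: "d > 0" "e > 0" using assms by auto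
    show "((\<lambda>t::real. t ^ (i div d) / t ^ i) \<longlongrightarrow> (if d = 1 then 1 else 0)) at_top"
    proof (cases "d = 1")
      case True
      have "eventually (\<lambda>t::real. t ^ (i div d) / t ^ i = 1) at_top"
        using eventually_gt_at_top[of 0] by eventually_elim (simp add: True)
      then show ?thesis using True by (simp add: tendsto_eventually)
    next
      case False
      then have le: "e < i" using pos by (simp add: e)
      have "((\<lambda>t::real. inverse (t ^ (i - e))) \<longlongrightarrow> 0) at_top"
        using le by (intro tendsto_inverse_0_at_top filterlim_pow_at_top filterlim_ident) auto
      moreover have "eventually (\<lambda>t::real. inverse (t ^ (i - e)) = t ^ (i div d) / t ^ i) at_top"
        using eventually_gt_at_top[of 0]
      proof eventually_elim
        case (elim t)
        then have "t ^ i = t ^ (i - e) * t ^ e" using le by (simp flip: power_add)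
        then show ?case using elim pos by (simp add: e field_simps)
      qed
      ultimately show ?thesis using False by (simp add: filterlim_cong)
    qed
  qed (use assms in auto)
  also have "(\<Sum>d | d dvd i. of_int (moebius_mu d) * (if d = 1 then 1 else 0 :: real)) = 1"
    using assms by (subst sum.remove[of _ 1]) auto
  finally have lim: "(?f \<longlongrightarrow> 1 / real i) at_top" .
  have eq: "?f t = poly (necklace_poly i) t / t ^ i" for t
  proof -
    have "?f t = (real i * poly (necklace_poly i) t) / t ^ i / real i"
      unfolding poly_necklace_poly[OF assms] by (simp add: sum_divide_distrib)
    then show ?thesis using assms by simp
  qed
  show ?thesis using lim unfolding eq .
qed

text \<open>The power \<open>t ^ (i * c)\<close> is distributed over the \<open>c\<close> factors
  \<open>f t - j\<close>; each quotient tends to \<open>L\<close>, as \<open>j / t ^ i\<close> tends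
  to 0.\<close>

lemma tendsto_gchoose_div_power:
  fixes f :: "real \<Rightarrow> real"
  assumes "((\<lambda>t. f t / t ^ i) \<longlongrightarrow> L) at_top" "i > 0"
  shows "((\<lambda>t. (f t gchoose c) / t ^ (i * c)) \<longlongrightarrow> L ^ c / fact c) at_top"
proof -
  have "((\<lambda>t::real. inverse (t ^ i)) \<longlongrightarrow> 0) at_top"
    using assms(2) by (intro tendsto_inverse_0_at_top filterlim_pow_at_top filterlim_ident)
  then have "((\<lambda>t. (\<Prod>j = 0..<c. f t / t ^ i - real j * inverse (t ^ i)) / fact c)
      \<longlongrightarrow> (\<Prod>j = 0..<c. L - real j * 0) / fact c) at_top"
    using assms(1) by (intro tendsto_intros) auto
  moreover have "(\<Prod>j = 0..<c. f t / t ^ i - real j * inverse (t ^ i)) / fact c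
      = (f t gchoose c) / t ^ (i * c)" for t
    by (simp add: gbinomial_prod_rev power_mult prod_dividef
        flip: diff_divide_distrib divide_inverse)
  ultimately show ?thesis by simp
qed

text \<open>Since the parts sum to \<open>n\<close>, the factor \<open>t ^ n\<close> splits into the
  powers \<open>t ^ (i * count \<mu> i)\<close>, leaving the prefactor \<open>t / (t - 1)\<close>.
  The product tends to the reciprocal of the centralizer order, and dividing by the class size gives
  \<open>1 / fact n\<close>.\<close>

lemma tendsto_splitting_weight:
  assumes "n \<ge> 1" "g \<in> carrier (sym_group n)"
  shows "((\<lambda>t::real. splitting_weight n t g) \<longlongrightarrow> 1 / fact n) at_top"
proof -
  define \<mu> where "\<mu> = cycle_type n g"
  define N where "N = real (card (cycle_class n \<mu>))"
  let ?M = "\<lambda>i t. poly (necklace_poly i) t"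
  have \<mu>: "\<mu> \<in> partitions_of n" unfolding \<mu>_def using assms by (intro cycle_type_in_partitions_of)
  then have sub: "set_mset \<mu> \<subseteq> {1..n}"
    by (simp add: partitions_of_eq_bounded bounded_partitions_def)
  have "((\<lambda>t::real. t / (t - 1) * (\<Prod>i = 1..n. (?M i t gchoose count \<mu> i) / t ^ (i * count \<mu> i)) / N)
      \<longlongrightarrow> 1 * (\<Prod>i = 1..n. (1 / real i) ^ count \<mu> i / fact (count \<mu> i)) / N) at_top"
  proof (rule tendsto_divide[OF tendsto_mult[OF _ tendsto_prod] tendsto_const])
    show "((\<lambda>t::real. t / (t - 1)) \<longlongrightarrow> 1) at_top" by real_asymp
    show "N \<noteq> 0" using card_cycle_class_pos[OF \<mu>] by (simp add: N_def)
  qed (auto intro!: tendsto_gchoose_div_power tendsto_necklace_poly)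
  also have "(\<Prod>i = 1..n. (1 / real i) ^ count \<mu> i / fact (count \<mu> i)) = 1 / real (centralizer_order \<mu>)"
    by (subst centralizer_order_superset[OF _ sub])
       (auto simp: prod_dividef power_one_over field_simps prod.distrib)
  also have "1 * (1 / real (centralizer_order \<mu>)) / N = 1 / fact n"
    using card_cycle_class[OF \<mu>, THEN arg_cong[of _ _ real]] by (simp add: N_def mult.commute)
  finally have lim: "((\<lambda>t::real. t / (t - 1) * (\<Prod>i = 1..n. (?M i t gchoose count \<mu> i) / t ^ (i * count \<mu> i)) / N)
      \<longlongrightarrow> 1 / fact n) at_top" .
  moreover have "eventually (\<lambda>t::real. t / (t - 1) * (\<Prod>i = 1..n. (?M i t gchoose count \<mu> i) / t ^ (i * count \<mu> i)) / N
      = splitting_weight n t g) at_top"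
    using eventually_gt_at_top[of 1]
  proof eventually_elim
    case (elim t)
    have "(\<Sum>i = 1..n. i * count \<mu> i) = n"
      using sum_mset_count[OF _ sub] \<mu> by (simp add: partitions_of_def)
    then have "(\<Prod>i = 1..n. t ^ (i * count \<mu> i)) = t ^ n" by (metis power_sum)
    moreover have "t ^ n = t ^ (n - 1) * t" using assms(1) by (cases n) auto
    ultimately show ?case using elim
      by (simp add: prod_dividef splitting_weight_def splitting_class_def N_def \<mu>_def[symmetric] mult_ac)
  qed
  ultimately show ?thesis by (rule Lim_transform_eventually)
qed

theorem theorem2p3:
  fixes n :: nat
  assumes "n \<ge> 2"
  shows "(\<forall>t::real. t > real n - 1 \<longrightarrow>
            (\<forall>g \<in> carrier (sym_group n). splitting_weight n t g > 0) \<and>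
            prob_space (splitting_measure n t) \<and>
            splitting_support n t = carrier (sym_group n))
       \<and> (\<forall>k::nat. k \<in> {2..n - 1} \<longrightarrow>
            (\<forall>g \<in> carrier (sym_group n). splitting_weight n (real k) g \<ge> 0) \<and>
            prob_space (splitting_measure n (real k)) \<and>
            splitting_support n (real k) \<noteq> carrier (sym_group n) \<and>
            splitting_class n (real k) (replicate_mset n 1) = 0 \<and>
            (\<forall>g \<in> cycle_class n (replicate_mset n 1). splitting_weight n (real k) g = 0))
       \<and> (\<forall>g \<in> carrier (sym_group n).
            ((\<lambda>t::real. splitting_weight n t g) \<longlongrightarrow> 1 / fact n) at_top)"
proof (intro conjI allI impI ballI)
  fix t :: real assume t: "t > real n - 1"
  show pos: "splitting_weight n t g > 0" if "g \<in> carrier (sym_group n)" for g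
    using assms t that by (rule splitting_weight_pos)
  show "prob_space (splitting_measure n t)"
    using assms t pos by (intro prob_space_splitting_measure) (auto intro: less_imp_le)
  show "splitting_support n t = carrier (sym_group n)"
    using pos by (force simp: splitting_support_def)
next
  fix k :: nat assume k: "k \<in> {2..n - 1}"
  then have k2: "k \<ge> 2" and kn: "k < n" by auto
  show nonneg: "splitting_weight n (real k) g \<ge> 0" for g
    using k2 by (rule splitting_weight_of_nat_nonneg)
  show "prob_space (splitting_measure n (real k))"
    using assms k2 nonneg by (intro prob_space_splitting_measure) auto
  show class0: "splitting_class n (real k) (replicate_mset n 1) = 0"
    using kn by (rule splitting_class_identity_eq_0)
  show weight0: "splitting_weight n (real k) g = 0" if "g \<in> cycle_class n (replicate_mset n 1)" for g
    using that class0 by (simp add: splitting_weight_def cycle_class_def)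
  \<comment> \<open>The identity has weight 0 and so witnesses that the support is not full.\<close>
  have "id \<in> carrier (sym_group n)" by (simp add: sym_group_carrier permutes_id)
  then show "splitting_support n (real k) \<noteq> carrier (sym_group n)"
    using weight0[of id] by (auto simp: splitting_support_def cycle_class_def cycle_type_id)
next
  fix g assume "g \<in> carrier (sym_group n)"
  then show "((\<lambda>t::real. splitting_weight n t g) \<longlongrightarrow> 1 / fact n) at_top"
    using assms by (intro tendsto_splitting_weight) auto
qed

end
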